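(* Let $\mathcal{H}$ be a separable complex Hilbert space and $J\subseteq\mathbb{N}$ an index set. Suppose that $T$, $W$ are symmetric operators in $\mathcal{H}$ such that $\mathrm{dom}(T)\subseteq\mathrm{dom}(W)$, and let $c>0$, $d>0$, $e\ge0$. Moreover, suppose $\Phi_j\in\mathcal{B}(\mathcal{H})$, $j\in J$, leave $\mathrm{dom}(T)$ invariant, that is, $\Phi_j\,\mathrm{dom}(T)\subseteq\mathrm{dom}(T)$, $j\in J$, and satisfy the following conditions: (i) $\sum_{j\in J}\Phi_j^*\Phi_j\le I_{\mathcal{H}}$. (ii) $\sum_{j\in J}\Phi_j^*W^2\Phi_j\ge c^{-1}W^2$ on $\mathrm{dom}(T)$. (iii) $\sum_{j\in J}\|T\Phi_jf\|_{\mathcal{H}}^2\le d\,\|Tf\|_{\mathcal{H}}^2+e\,\|f\|_{\mathcal{H}}^2$ for all $f\in\mathrm{dom}(T)$. Let $a,b\in[0,\infty)$. Then $$\|W\Phi_jf\|_{\mathcal{H}}^2\le a\,\|T\Phi_jf\|_{\mathcal{H}}^2+b\,\|\Phi_jf\|_{\mathcal{H}}^2,\qquad f\in\mathrm{dom}(T),\ j\in J,$$ implies $$\|Wf\|_{\mathcal{H}}^2\le a\,c\,d\,\|Tf\|_{\mathcal{H}}^2+[a\,c\,e+b\,c]\,\|f\|_{\mathcal{H}}^2,\qquad f\in\mathrm{dom}(T).$$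
   Context: $\mathcal{B}(\mathcal{H})$ denotes the bounded linear operators on $\mathcal{H}$. A densely defined operator $A$ is symmetric if $A\subseteq A^*$. Infinite sums of operators are understood in the weak operator topology. Condition (ii) is understood in the sense of quadratic forms, i.e. $\sum_{j\in J}\|W\Phi_jf\|_{\mathcal{H}}^2\ge c^{-1}\|Wf\|_{\mathcal{H}}^2$ for all $f\in\mathrm{dom}(T)$. *)

theory Defs
  imports "HOL-Analysis.Analysis" "HOL-Library.Complex_Order"
begin

text \<open>Complex Hilbert spaces. The inner product is linear in its first argument. Norm, metric
  and topology are those of the underlying real normed space and are tied to the complex structure
  by the axioms \<open>scaleR_scaleC\<close> and \<open>norm_eq_sqrt_cinner\<close>.\<close>

class complex_inner = real_normed_vector +
  fixes scaleC :: "complex \<Rightarrow> 'a \<Rightarrow> 'a"  (infixr \<open>*\<^sub>C\<close> 75)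
    and cinner :: "'a \<Rightarrow> 'a \<Rightarrow> complex"
  assumes scaleC_add_right: "z *\<^sub>C (x + y) = z *\<^sub>C x + z *\<^sub>C y"
    and scaleC_add_left: "(z + w) *\<^sub>C x = z *\<^sub>C x + w *\<^sub>C x"
    and scaleC_scaleC: "z *\<^sub>C (w *\<^sub>C x) = (z * w) *\<^sub>C x"
    and scaleR_scaleC: "scaleR r x = complex_of_real r *\<^sub>C x"
    and cinner_commute: "cinner x y = cnj (cinner y x)"
    and cinner_add_left: "cinner (x + x') y = cinner x y + cinner x' y"
    and cinner_scaleC_left: "cinner (w *\<^sub>C x) y = w * cinner x y"
    and cinner_ge_zero: "0 \<le> cinner x x"
    and cinner_eq_zero_iff: "cinner x x = 0 \<longleftrightarrow> x = 0"
    and norm_eq_sqrt_cinner: "norm x = sqrt (Re (cinner x x))"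

class complex_hilbert_space = complex_inner + complete_space

text \<open>A possibly unbounded operator is a domain together with a function whose values outside the
  domain are irrelevant. In particular, equality of values of this type is finer than equality of
  operators; operators are only compared through \<open>op_extends\<close> and \<open>op_le\<close>.\<close>

datatype 'a operator = Operator (op_dom: "'a set") (op_app: "'a \<Rightarrow> 'a")

notation op_app  (infixl \<open>\<bullet>\<^sub>o\<close> 90)

definition csubspace :: "'a::complex_inner set \<Rightarrow> bool" where
  "csubspace S \<longleftrightarrow> 0 \<in> S \<and> (\<forall>x\<in>S. \<forall>y\<in>S. x + y \<in> S) \<and> (\<forall>z. \<forall>x\<in>S. z *\<^sub>C x \<in> S)"

definition linear_operator :: "'a::complex_inner operator \<Rightarrow> bool" where
  "linear_operator A \<longleftrightarrow> csubspace (op_dom A)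
     \<and> (\<forall>x\<in>op_dom A. \<forall>y\<in>op_dom A. A \<bullet>\<^sub>o (x + y) = A \<bullet>\<^sub>o x + A \<bullet>\<^sub>o y)
     \<and> (\<forall>z. \<forall>x\<in>op_dom A. A \<bullet>\<^sub>o (z *\<^sub>C x) = z *\<^sub>C (A \<bullet>\<^sub>o x))"

definition densely_defined :: "'a::complex_inner operator \<Rightarrow> bool" where
  "densely_defined A \<longleftrightarrow> closure (op_dom A) = UNIV"

definition op_extends :: "'a operator \<Rightarrow> 'a operator \<Rightarrow> bool"  (infix \<open>\<subseteq>\<^sub>o\<close> 50) where
  "A \<subseteq>\<^sub>o B \<longleftrightarrow> op_dom A \<subseteq> op_dom B \<and> (\<forall>x\<in>op_dom A. A \<bullet>\<^sub>o x = B \<bullet>\<^sub>o x)"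

text \<open>The adjoint is meaningful only for densely defined \<open>A\<close>, when the vector \<open>z\<close> is unique.\<close>

definition adjoint_op :: "'a::complex_inner operator \<Rightarrow> 'a operator" where
  "adjoint_op A = Operator
     {y. \<exists>z. \<forall>x\<in>op_dom A. cinner (A \<bullet>\<^sub>o x) y = cinner x z}
     (\<lambda>y. THE z. \<forall>x\<in>op_dom A. cinner (A \<bullet>\<^sub>o x) y = cinner x z)"

definition symmetric_operator :: "'a::complex_inner operator \<Rightarrow> bool" where
  "symmetric_operator A \<longleftrightarrow> linear_operator A \<and> densely_defined A \<and> A \<subseteq>\<^sub>o adjoint_op A"

definition bounded_operator :: "'a::complex_inner operator \<Rightarrow> bool" where
  "bounded_operator A \<longleftrightarrow> linear_operator A \<and> op_dom A = UNIV
     \<and> (\<exists>K. \<forall>x. norm (A \<bullet>\<^sub>o x) \<le> K * norm x)"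

definition op_comp :: "'a operator \<Rightarrow> 'a operator \<Rightarrow> 'a operator"  (infixl \<open>\<circ>\<^sub>o\<close> 75) where
  "A \<circ>\<^sub>o B = Operator {x \<in> op_dom B. B \<bullet>\<^sub>o x \<in> op_dom A} (\<lambda>x. A \<bullet>\<^sub>o (B \<bullet>\<^sub>o x))"

definition id_op :: "'a operator" where
  "id_op = Operator UNIV (\<lambda>x. x)"

text \<open>Order of bounded operators: \<open>B - A\<close> is positive. The inequality is the one on the complex
  numbers (equal imaginary parts, real parts ordered).\<close>

definition op_le :: "'a::complex_inner operator \<Rightarrow> 'a operator \<Rightarrow> bool"  (infix \<open>\<le>\<^sub>o\<close> 50) where
  "A \<le>\<^sub>o B \<longleftrightarrow> (\<forall>x. cinner (A \<bullet>\<^sub>o x) x \<le> cinner (B \<bullet>\<^sub>o x) x)"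

text \<open>\<open>S\<close> is the sum of the family \<open>A j\<close>, \<open>j \<in> J\<close>, of bounded operators in the weak operator
  topology. For positive \<open>A j\<close> (the only case used) unconditional convergence and convergence of
  the series in the order of the naturals coincide, by polarization.\<close>

definition wot_has_sum :: "('i \<Rightarrow> 'a::complex_inner operator) \<Rightarrow> 'a operator \<Rightarrow> 'i set \<Rightarrow> bool" where
  "wot_has_sum A S J \<longleftrightarrow> bounded_operator S
     \<and> (\<forall>x y. ((\<lambda>j. cinner (A j \<bullet>\<^sub>o x) y) has_sum cinner (S \<bullet>\<^sub>o x) y) J)"

end

theory Submission
  imports Defs
begin

text \<open>Fix \<open>f\<close> in the domain of \<open>T\<close>. Condition (i), evaluated on the quadratic form at \<open>f\<close>, says that
  the numbers \<open>\<parallel>\<Phi>\<^sub>j f\<parallel>\<^sup>2\<close> sum up to at most \<open>\<parallel>f\<parallel>\<^sup>2\<close>. Summing the local bounds over \<open>j\<close> and using (ii)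
  for the left-hand side, (iii) for the \<open>T\<close>-term and (i) for the remaining term gives
  \<open>c\<^sup>-\<^sup>1 \<parallel>W f\<parallel>\<^sup>2 \<le> a (d \<parallel>T f\<parallel>\<^sup>2 + e \<parallel>f\<parallel>\<^sup>2) + b \<parallel>f\<parallel>\<^sup>2\<close>, which is the claim up to the factor \<open>c\<close>.

  The substance is in reading (i) this way. The summand there involves \<open>adjoint_op (\<Phi> j)\<close>, whose value
  at a vector is a definite description; it satisfies the adjoint identity only once a representing
  vector is known to exist. Existence is the Riesz representation theorem, so it is proved for
  complex Hilbert spaces (\<open>riesz_representation\<close>), by minimising the functional
  \<open>\<parallel>x\<parallel>\<^sup>2 - 2 Re \<phi>(x)\<close>. The identity \<open>\<langle>\<Phi>\<^sup>* \<Phi> f, f\<rangle> = \<parallel>\<Phi> f\<parallel>\<^sup>2\<close> (\<open>cinner_adjoint_comp_self\<close>) follows.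

  Sums with values in \<open>[0, \<infinity>]\<close> are compared through their finite partial sums
  (\<open>infsum_ennreal_le_iff\<close>), so that all estimates take place in the reals.\<close>

section \<open>Real and complex structure of the inner product\<close>

lemma cinner_add_right:
  "cinner x (y + z) = cinner x y + cinner x (z::'a::complex_inner)"
  by (subst (1 2 3) cinner_commute) (simp add: cinner_add_left)

lemma cinner_scaleC_right:
  "cinner x (w *\<^sub>C y) = cnj w * cinner x (y::'a::complex_inner)"
  by (subst (1 2) cinner_commute) (simp add: cinner_scaleC_left)

lemma cinner_self: "cinner x x = complex_of_real ((norm (x::'a::complex_inner))\<^sup>2)"
  using cinner_ge_zero[of x] by (simp add: complex_eq_iff less_eq_complex_def norm_eq_sqrt_cinner)

lemma Re_cinner_commute: "Re (cinner x y) = Re (cinner y (x::'a::complex_inner))"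
  by (subst cinner_commute) simp

lemma Re_cinner_scaleR_left: "Re (cinner (r *\<^sub>R x) y) = r * Re (cinner x (y::'a::complex_inner))"
  by (simp add: scaleR_scaleC cinner_scaleC_left)

lemma Re_cinner_scaleR_right: "Re (cinner x (r *\<^sub>R y)) = r * Re (cinner x (y::'a::complex_inner))"
  by (simp add: scaleR_scaleC cinner_scaleC_right)

lemma norm_add_square:
  "(norm (x + y))\<^sup>2 = (norm x)\<^sup>2 + 2 * Re (cinner x y) + (norm (y::'a::complex_inner))\<^sup>2"
proof -
  have sq: "(norm u)\<^sup>2 = Re (cinner u u)" for u :: 'a
    by (simp add: cinner_self)
  show ?thesis
    unfolding sq using Re_cinner_commute[of y x]
    by (simp add: cinner_add_left cinner_add_right)
qed

text \<open>Since the norm is already known to satisfy the triangle inequality, the Cauchy--Schwarz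
  inequality can be read off from the expansion of \<open>\<parallel>x + y\<parallel>\<^sup>2\<close>.\<close>

lemma Re_cinner_le_norm: "Re (cinner x y) \<le> norm x * norm (y::'a::complex_inner)"
proof -
  have "(norm (x + y))\<^sup>2 \<le> (norm x + norm y)\<^sup>2"
    by (intro power_mono norm_triangle_ineq norm_ge_zero)
  then show ?thesis
    by (simp add: norm_add_square power2_sum)
qed

lemma abs_Re_cinner_le_norm: "\<bar>Re (cinner x y)\<bar> \<le> norm x * norm (y::'a::complex_inner)"
  using Re_cinner_le_norm[of x y] Re_cinner_le_norm[of "-x" y]
    Re_cinner_scaleR_left[of "-1" x y] by simp

lemma cinner_cong_right_unique:
  assumes "\<And>x. cinner x y = cinner x (z::'a::complex_inner)"
  shows "y = z"
proof -
  have "cinner (y - z) (y - z) = cinner (y - z) y + cinner (y - z) ((-1) *\<^sub>R z)"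
    by (simp flip: cinner_add_right)
  also have "\<dots> = 0"
    by (simp add: assms scaleR_scaleC cinner_scaleC_right)
  finally show ?thesis
    by (simp add: cinner_eq_zero_iff)
qed

section \<open>Riesz representation\<close>

text \<open>The functional \<open>q(x) = \<parallel>x\<parallel>\<^sup>2 - 2 g(x)\<close> is bounded below, and the parallelogram law shows that
  almost-minimisers are close to each other. Hence a minimising sequence converges to a minimiser
  \<open>z\<close>, and \<open>g = Re \<langle>\<cdot>, z\<rangle>\<close> is the condition that the derivative of \<open>q\<close> vanishes at \<open>z\<close>.\<close>

lemma riesz_representation_real:
  fixes g :: "'a::complex_hilbert_space \<Rightarrow> real"
  assumes g: "bounded_linear g"
  shows "\<exists>z. \<forall>x. g x = Re (cinner x z)"
proof -
  interpret g: bounded_linear g by (fact g)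
  define q where "q = (\<lambda>x. (norm x)\<^sup>2 - 2 * g x)"
  obtain K where K: "\<And>x. norm (g x) \<le> norm x * K"
    using g.bounded by blast
  have q_lower: "- K\<^sup>2 \<le> q x" for x
  proof -
    have "0 \<le> (norm x - K)\<^sup>2" by simp
    then show ?thesis
      using K[of x] by (simp add: q_def power2_diff)
  qed
  define m where "m = Inf (range q)"
  have bdd: "bdd_below (range q)"
    using q_lower by (auto intro!: bdd_belowI)
  have m_le: "m \<le> q x" for x
    unfolding m_def by (intro cInf_lower bdd) auto
  have q_parallelogram:
    "q x + q y = 2 * q ((1/2) *\<^sub>R (x + y)) + (norm (x - y))\<^sup>2 / 2" for x y
  proof -
    have "(norm (x - y))\<^sup>2 = (norm x)\<^sup>2 - 2 * Re (cinner x y) + (norm y)\<^sup>2"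
      using norm_add_square[of x "(-1) *\<^sub>R y"] Re_cinner_scaleR_right[of x "-1" y] by simp
    moreover have "(norm ((1/2) *\<^sub>R (x + y)))\<^sup>2 = (norm (x + y))\<^sup>2 / 4"
      by (simp add: power_divide)
    moreover have "g ((1/2) *\<^sub>R (x + y)) = (g x + g y) / 2"
      by (simp add: g.scaleR g.add)
    ultimately show ?thesis
      unfolding q_def using norm_add_square[of x y] by (simp add: field_simps)
  qed
  have close: "(norm (x - y))\<^sup>2 \<le> 4 * \<epsilon>" if "q x \<le> m + \<epsilon>" "q y \<le> m + \<epsilon>" for x y \<epsilon>
    using that q_parallelogram[of x y] m_le[of "(1/2) *\<^sub>R (x + y)"] by linarith
  have "\<exists>x. q x < m + inverse (real (Suc n))" for n
    using cInf_lessD[of "range q" "m + inverse (real (Suc n))"] by (auto simp: m_def)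
  then obtain X where X: "\<And>n. q (X n) < m + inverse (real (Suc n))"
    by metis
  have "Cauchy X"
  proof (rule metric_CauchyI)
    fix \<epsilon> :: real
    assume "0 < \<epsilon>"
    then obtain N where N: "inverse (real (Suc N)) < \<epsilon>\<^sup>2 / 4"
      using reals_Archimedean[of "\<epsilon>\<^sup>2 / 4"] by auto
    have qN: "q (X n) \<le> m + inverse (real (Suc N))" if "n \<ge> N" for n
    proof -
      have "inverse (real (Suc n)) \<le> inverse (real (Suc N))"
        using that by (simp add: field_simps)
      then show ?thesis using X[of n] by linarith
    qed
    have "dist (X k) (X n) < \<epsilon>" if "k \<ge> N" "n \<ge> N" for k n
    proof -
      have "(norm (X k - X n))\<^sup>2 < \<epsilon>\<^sup>2"
        using close[OF qN[OF that(1)] qN[OF that(2)]] N by linarith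
      then show ?thesis
        using \<open>0 < \<epsilon>\<close> by (simp add: dist_norm power2_less_imp_less)
    qed
    then show "\<exists>N. \<forall>k\<ge>N. \<forall>n\<ge>N. dist (X k) (X n) < \<epsilon>" by blast
  qed
  then obtain z where z: "X \<longlonglongrightarrow> z"
    using Cauchy_convergent_iff convergent_def by blast
  have "(\<lambda>n. q (X n)) \<longlonglongrightarrow> q z"
    unfolding q_def by (intro tendsto_intros g.tendsto z)
  moreover have "(\<lambda>n. m + inverse (real (Suc n))) \<longlonglongrightarrow> m + 0"
    by (intro tendsto_intros LIMSEQ_inverse_real_of_nat)
  ultimately have "q z \<le> m"
    using LIMSEQ_le[of "\<lambda>n. q (X n)" "q z" "\<lambda>n. m + inverse (real (Suc n))" "m + 0"] X
    by (auto intro: less_imp_le)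
  then have min: "q z \<le> q x" for x
    using m_le[of x] by linarith
  have "g x = Re (cinner x z)" for x
  proof (cases "x = 0")
    case True
    then show ?thesis
      using Re_cinner_scaleR_left[of 0 0 z] by (simp add: g.zero)
  next
    case False
    define \<delta> where "\<delta> = g x - Re (cinner x z)"
    \<comment> \<open>The step size minimising the quadratic polynomial \<open>t \<mapsto> q (z + t *\<^sub>R x)\<close>.\<close>
    define t where "t = \<delta> / (norm x)\<^sup>2"
    have "q (z + t *\<^sub>R x) = q z - 2 * t * \<delta> + t\<^sup>2 * (norm x)\<^sup>2"
      using Re_cinner_commute[of z x]
      by (simp add: q_def \<delta>_def norm_add_square g.add g.scaleR Re_cinner_scaleR_right
          power_mult_distrib algebra_simps)
    also have "\<dots> = q z - \<delta>\<^sup>2 / (norm x)\<^sup>2"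
      using False by (simp add: t_def field_simps power2_eq_square)
    finally have "\<delta>\<^sup>2 / (norm x)\<^sup>2 \<le> 0"
      using min[of "z + t *\<^sub>R x"] by linarith
    then have "\<delta> = 0"
      using False by (simp add: divide_le_0_iff)
    then show ?thesis
      by (simp add: \<delta>_def)
  qed
  then show ?thesis by blast
qed

text \<open>A complex-linear functional is determined by its real part, because \<open>Im \<phi>(x) = Re \<phi>(-\<i> x)\<close>.\<close>

lemma riesz_representation:
  fixes \<phi> :: "'a::complex_hilbert_space \<Rightarrow> complex"
  assumes add: "\<And>x y. \<phi> (x + y) = \<phi> x + \<phi> y"
    and scale: "\<And>w x. \<phi> (w *\<^sub>C x) = w * \<phi> x"
    and bound: "\<And>x. \<bar>Re (\<phi> x)\<bar> \<le> norm x * K"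
  shows "\<exists>z. \<forall>x. \<phi> x = cinner x z"
proof -
  have "bounded_linear (\<lambda>x. Re (\<phi> x))"
    by (rule bounded_linear_intro[where K = K])
      (use bound in \<open>simp_all add: add scale scaleR_scaleC\<close>)
  then obtain z where z: "\<And>x. Re (\<phi> x) = Re (cinner x z)"
    using riesz_representation_real by blast
  have "Im (\<phi> x) = Im (cinner x z)" for x
    using z[of "(- \<i>) *\<^sub>C x"] by (simp add: scale cinner_scaleC_left)
  then show ?thesis
    using z complex_eq_iff by blast
qed

section \<open>Adjoints of bounded operators\<close>

lemma cinner_adjoint_bounded:
  fixes A :: "'a::complex_hilbert_space operator"
  assumes "bounded_operator A"
  shows "cinner (A \<bullet>\<^sub>o x) y = cinner x (adjoint_op A \<bullet>\<^sub>o y)"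
proof -
  from assms obtain K where dom: "op_dom A = UNIV" and K: "\<And>x. norm (A \<bullet>\<^sub>o x) \<le> K * norm x"
    and add: "\<And>x y. A \<bullet>\<^sub>o (x + y) = A \<bullet>\<^sub>o x + A \<bullet>\<^sub>o y"
    and scale: "\<And>w x. A \<bullet>\<^sub>o (w *\<^sub>C x) = w *\<^sub>C (A \<bullet>\<^sub>o x)"
    unfolding bounded_operator_def linear_operator_def by auto
  have "\<bar>Re (cinner (A \<bullet>\<^sub>o x) y)\<bar> \<le> norm x * (K * norm y)" for x
    using abs_Re_cinner_le_norm[of "A \<bullet>\<^sub>o x" y] mult_right_mono[OF K[of x] norm_ge_zero[of y]]
    by (simp add: mult_ac)
  then have "\<exists>z. \<forall>x. cinner (A \<bullet>\<^sub>o x) y = cinner x z"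
    by (intro riesz_representation) (simp_all add: add scale cinner_add_left cinner_scaleC_left)
  then have "\<exists>!z. \<forall>x. cinner (A \<bullet>\<^sub>o x) y = cinner x z"
    using cinner_cong_right_unique by metis
  from theI'[OF this]
  have "cinner (A \<bullet>\<^sub>o x) y = cinner x (THE z. \<forall>x. cinner (A \<bullet>\<^sub>o x) y = cinner x z)"
    by (rule spec)
  also have "(THE z. \<forall>x. cinner (A \<bullet>\<^sub>o x) y = cinner x z) = adjoint_op A \<bullet>\<^sub>o y"
    by (simp add: adjoint_op_def dom)
  finally show ?thesis .
qed

lemma cinner_adjoint_comp_self:
  fixes A :: "'a::complex_hilbert_space operator"
  assumes "bounded_operator A"
  shows "cinner ((adjoint_op A \<circ>\<^sub>o A) \<bullet>\<^sub>o x) x = complex_of_real ((norm (A \<bullet>\<^sub>o x))\<^sup>2)"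
proof -
  have "cinner x (adjoint_op A \<bullet>\<^sub>o (A \<bullet>\<^sub>o x)) = complex_of_real ((norm (A \<bullet>\<^sub>o x))\<^sup>2)"
    using cinner_adjoint_bounded[OF assms, of x "A \<bullet>\<^sub>o x"] by (simp add: cinner_self)
  then show ?thesis
    using cinner_commute[of "adjoint_op A \<bullet>\<^sub>o (A \<bullet>\<^sub>o x)" x] by (simp add: op_comp_def)
qed

text \<open>This is the quadratic-form content of \<open>\<Sum>\<^sub>j \<Phi>\<^sub>j\<^sup>* \<Phi>\<^sub>j \<le> I\<close>; finite partial sums suffice because
  the terms are nonnegative.\<close>

lemma sum_norm_square_le_if_wot_sum_le_id:
  fixes \<Phi> :: "'i \<Rightarrow> 'a::complex_hilbert_space operator"
  assumes bounded: "\<And>j. j \<in> J \<Longrightarrow> bounded_operator (\<Phi> j)"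
    and S: "wot_has_sum (\<lambda>j. adjoint_op (\<Phi> j) \<circ>\<^sub>o \<Phi> j) S J" "S \<le>\<^sub>o id_op"
    and F: "finite F" "F \<subseteq> J"
  shows "(\<Sum>j\<in>F. (norm (\<Phi> j \<bullet>\<^sub>o x))\<^sup>2) \<le> (norm x)\<^sup>2"
proof -
  have "((\<lambda>j. cinner ((adjoint_op (\<Phi> j) \<circ>\<^sub>o \<Phi> j) \<bullet>\<^sub>o x) x) has_sum cinner (S \<bullet>\<^sub>o x) x) J"
    using S(1) by (simp add: wot_has_sum_def)
  then have "((\<lambda>j. complex_of_real ((norm (\<Phi> j \<bullet>\<^sub>o x))\<^sup>2)) has_sum cinner (S \<bullet>\<^sub>o x) x) J"
    by (rule iffD1[OF has_sum_cong, rotated]) (rule cinner_adjoint_comp_self[OF bounded])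
  from has_sum_Re[OF this]
  have "((\<lambda>j. (norm (\<Phi> j \<bullet>\<^sub>o x))\<^sup>2) has_sum Re (cinner (S \<bullet>\<^sub>o x) x)) J"
    by simp
  then have "(\<Sum>j\<in>F. (norm (\<Phi> j \<bullet>\<^sub>o x))\<^sup>2) \<le> Re (cinner (S \<bullet>\<^sub>o x) x)"
    using F by (intro finite_sum_le_has_sum) auto
  also have "\<dots> \<le> Re (cinner x x)"
    using S(2) by (simp add: op_le_def id_op_def less_eq_complex_def)
  finally show ?thesis
    by (simp add: cinner_self)
qed

section \<open>Summation of the local bounds\<close>

lemma infsum_ennreal_le_iff:
  fixes g :: "'i \<Rightarrow> real"
  assumes g: "\<And>j. j \<in> J \<Longrightarrow> 0 \<le> g j" and B: "0 \<le> B"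
  shows "(\<Sum>\<^sub>\<infinity>j\<in>J. ennreal (g j)) \<le> ennreal B
    \<longleftrightarrow> (\<forall>F. finite F \<and> F \<subseteq> J \<longrightarrow> (\<Sum>j\<in>F. g j) \<le> B)"
proof -
  have "(\<Sum>\<^sub>\<infinity>j\<in>J. ennreal (g j)) = (SUP F\<in>{F. finite F \<and> F \<subseteq> J}. \<Sum>j\<in>F. ennreal (g j))"
    by (intro nonneg_infsum_complete) simp
  also have "\<dots> = (SUP F\<in>{F. finite F \<and> F \<subseteq> J}. ennreal (\<Sum>j\<in>F. g j))"
    using g by (intro SUP_cong refl sum_ennreal) auto
  finally show ?thesis
    using B by (auto simp: SUP_le_iff ennreal_le_iff)
qed

theorem theorem3p4:
  fixes T W :: "'h::complex_hilbert_space operator"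
    and \<Phi> :: "nat \<Rightarrow> 'h operator"
    and J :: "nat set"
    and a b c d e :: real
  assumes separable: "separable_space (euclidean :: 'h topology)"
    and T: "symmetric_operator T" and W: "symmetric_operator W"
    and dom: "op_dom T \<subseteq> op_dom W"
    and c: "c > 0" and d: "d > 0" and e: "e \<ge> 0"
    and bounded: "\<And>j. j \<in> J \<Longrightarrow> bounded_operator (\<Phi> j)"
    and invariant: "\<And>j. j \<in> J \<Longrightarrow> op_app (\<Phi> j) ` op_dom T \<subseteq> op_dom T"
    and i: "\<exists>S. wot_has_sum (\<lambda>j. adjoint_op (\<Phi> j) \<circ>\<^sub>o \<Phi> j) S J \<and> S \<le>\<^sub>o id_op"
    and ii: "\<And>f. f \<in> op_dom T \<Longrightarrow>
      (\<Sum>\<^sub>\<infinity>j\<in>J. ennreal ((norm (W \<bullet>\<^sub>o (\<Phi> j \<bullet>\<^sub>o f)))\<^sup>2)) \<ge> ennreal (inverse c * (norm (W \<bullet>\<^sub>o f))\<^sup>2)"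
    and iii: "\<And>f. f \<in> op_dom T \<Longrightarrow>
      (\<Sum>\<^sub>\<infinity>j\<in>J. ennreal ((norm (T \<bullet>\<^sub>o (\<Phi> j \<bullet>\<^sub>o f)))\<^sup>2))
        \<le> ennreal (d * (norm (T \<bullet>\<^sub>o f))\<^sup>2 + e * (norm f)\<^sup>2)"
    and a: "a \<ge> 0" and b: "b \<ge> 0"
    and local_bound: "\<And>f j. f \<in> op_dom T \<Longrightarrow> j \<in> J \<Longrightarrow>
      (norm (W \<bullet>\<^sub>o (\<Phi> j \<bullet>\<^sub>o f)))\<^sup>2
        \<le> a * (norm (T \<bullet>\<^sub>o (\<Phi> j \<bullet>\<^sub>o f)))\<^sup>2 + b * (norm (\<Phi> j \<bullet>\<^sub>o f))\<^sup>2"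
  shows "\<And>f. f \<in> op_dom T \<Longrightarrow>
      (norm (W \<bullet>\<^sub>o f))\<^sup>2
        \<le> a * c * d * (norm (T \<bullet>\<^sub>o f))\<^sup>2 + (a * c * e + b * c) * (norm f)\<^sup>2"
proof -
  fix f
  assume f: "f \<in> op_dom T"
  obtain S where S: "wot_has_sum (\<lambda>j. adjoint_op (\<Phi> j) \<circ>\<^sub>o \<Phi> j) S J" "S \<le>\<^sub>o id_op"
    using i by blast
  let ?B = "d * (norm (T \<bullet>\<^sub>o f))\<^sup>2 + e * (norm f)\<^sup>2"
  have B: "0 \<le> ?B"
    using d e by simp
  have partial: "(\<Sum>j\<in>F. (norm (W \<bullet>\<^sub>o (\<Phi> j \<bullet>\<^sub>o f)))\<^sup>2) \<le> a * ?B + b * (norm f)\<^sup>2"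
    if F: "finite F" "F \<subseteq> J" for F
  proof -
    have "(\<Sum>j\<in>F. (norm (W \<bullet>\<^sub>o (\<Phi> j \<bullet>\<^sub>o f)))\<^sup>2)
        \<le> (\<Sum>j\<in>F. a * (norm (T \<bullet>\<^sub>o (\<Phi> j \<bullet>\<^sub>o f)))\<^sup>2 + b * (norm (\<Phi> j \<bullet>\<^sub>o f))\<^sup>2)"
      using F f local_bound by (intro sum_mono) auto
    also have "\<dots> = a * (\<Sum>j\<in>F. (norm (T \<bullet>\<^sub>o (\<Phi> j \<bullet>\<^sub>o f)))\<^sup>2) + b * (\<Sum>j\<in>F. (norm (\<Phi> j \<bullet>\<^sub>o f))\<^sup>2)"
      by (simp add: sum.distrib sum_distrib_left)
    also have "\<dots> \<le> a * ?B + b * (norm f)\<^sup>2"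
    proof (intro add_mono mult_left_mono a b)
      show "(\<Sum>j\<in>F. (norm (T \<bullet>\<^sub>o (\<Phi> j \<bullet>\<^sub>o f)))\<^sup>2) \<le> ?B"
        using iii[OF f] infsum_ennreal_le_iff[of J "\<lambda>j. (norm (T \<bullet>\<^sub>o (\<Phi> j \<bullet>\<^sub>o f)))\<^sup>2", OF _ B] F
        by simp
      show "(\<Sum>j\<in>F. (norm (\<Phi> j \<bullet>\<^sub>o f))\<^sup>2) \<le> (norm f)\<^sup>2"
        by (rule sum_norm_square_le_if_wot_sum_le_id[OF bounded S F])
    qed
    finally show ?thesis .
  qed
  have bound: "0 \<le> a * ?B + b * (norm f)\<^sup>2"
    using a b B by simp
  have "ennreal (inverse c * (norm (W \<bullet>\<^sub>o f))\<^sup>2)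
      \<le> (\<Sum>\<^sub>\<infinity>j\<in>J. ennreal ((norm (W \<bullet>\<^sub>o (\<Phi> j \<bullet>\<^sub>o f)))\<^sup>2))"
    by (rule ii[OF f])
  also have "\<dots> \<le> ennreal (a * ?B + b * (norm f)\<^sup>2)"
    by (subst infsum_ennreal_le_iff[OF _ bound]) (use partial in auto)
  finally have "inverse c * (norm (W \<bullet>\<^sub>o f))\<^sup>2 \<le> a * ?B + b * (norm f)\<^sup>2"
    using bound by (simp add: ennreal_le_iff)
  then have "(norm (W \<bullet>\<^sub>o f))\<^sup>2 \<le> c * (a * ?B + b * (norm f)\<^sup>2)"
    using c by (simp add: field_simps)
  then show "(norm (W \<bullet>\<^sub>o f))\<^sup>2
      \<le> a * c * d * (norm (T \<bullet>\<^sub>o f))\<^sup>2 + (a * c * e + b * c) * (norm f)\<^sup>2"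
    by (simp add: algebra_simps)
qed

end
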